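(* Let $W=(W(n))_{n\ge 0}$ be a simple random walk on $\mathbb{Z}$ with $W(0)=0$, and let $\{\eta_\alpha(e)\}$, indexed by the edges $e$ of $\mathbb{Z}$, be i.i.d. rewards independent of $W$. Let $A_n=A_n(\eta_\alpha,W)$ be the random walk at random time with rewards $\eta_\alpha$ and random time process $W$. Let $p\in\mathbb{N}$ and define the $p$-th variation $$V^{(p)}_n:=\sum_{i=1}^n (A_i-A_{i-1})^p .$$ Suppose that the i.i.d. rewards $\{\eta_\alpha(e)\}$ are symmetric and have finite $p$-th moments, and put $$\zeta^{(p)}(e):=\eta_\alpha(e)^p-\mathbf{E}[\eta_\alpha(e)^p].$$ If $p$ is odd, then $V_n^{(p)}$ is the random walk at random time with rewards $\{\zeta^{(p)}(e)\}$ and random time process $W$, i.e. $V^{(p)}_n=A_n(\zeta^{(p)},W)$ for all $n$. If $p$ is even, then $V^{(p)}_n-n\,\mathbf{E}[\eta_\alpha^p]$ (where $\eta_\alpha$ denotes a generic reward) is the random walk in random scenery with rewards $\{\zeta^{(p)}(e)\}$ and collecting process $W$, i.e. $V^{(p)}_n-n\,\mathbf{E}[\eta_\alpha^p]=Z_n(\zeta^{(p)},W)$ for all $n$.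
   Context: Edges of $\mathbb{Z}$ are the pairs $\{k,k+1\}$, $k\in\mathbb{Z}$. Let $W$ be a simple random walk on $\mathbb{Z}$ with $W(0)=0$. For $i\ge1$ let $\mathcal{E}_i$ denote the edge between $W(i-1)$ and $W(i)$. Let $\{\eta(e)\}$ be a family of i.i.d. random variables (rewards, or scenery) indexed by the edges of $\mathbb{Z}$ and independent of $W$. Random walk in random scenery (with rewards on the edges): $Z_n(\eta,W):=\sum_{i=1}^n\eta(\mathcal{E}_i)$. Random walk at random time: each edge $e$ carries a sign $\sigma_e(n)\in\{-1,+1\}$, with $\sigma_e(0)=+1$; at step $k$ the sign of the traversed edge $\mathcal{E}_k$ is reversed (so $\sigma_{\mathcal{E}_k}(k)=-\sigma_{\mathcal{E}_k}(k-1)$) and all other signs are unchanged. Then $$A_n(\eta,W):=\sum_{k=1}^n\sigma_{\mathcal{E}_k}(k-1)\,\eta(\mathcal{E}_k),\qquad A_0=0.$$ Standing assumption on the original rewards: $\eta_\alpha(e)$ is in the domain of attraction of a symmetric $\alpha$-stable law, $\alpha\in(0,2]$. This is not part of the definitions of $Z_n$ and $A_n$ given here, which are used for arbitrary i.i.d. rewards independent of $W$. *)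

theory Defs
  imports "HOL-Probability.Probability"
begin

typedef edge = "{e :: int set. \<exists>k. e = {k, k + 1}}"
  by blast

text \<open>Meaningful when \<open>x\<close> and \<open>y\<close> are adjacent; otherwise an unspecified edge.\<close>
definition edge_between :: "int \<Rightarrow> int \<Rightarrow> edge" where
  "edge_between x y = Abs_edge {x, y}"

definition simple_random_walk :: "'a measure \<Rightarrow> (nat \<Rightarrow> 'a \<Rightarrow> int) \<Rightarrow> bool" where
  "simple_random_walk M W \<longleftrightarrow>
     (\<forall>\<omega>\<in>space M. W 0 \<omega> = 0) \<and>
     prob_space.indep_vars M (\<lambda>_. count_space UNIV) (\<lambda>i \<omega>. W (Suc i) \<omega> - W i \<omega>) UNIV \<and>
     (\<forall>i. distr M (count_space UNIV) (\<lambda>\<omega>. W (Suc i) \<omega> - W i \<omega>)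
            = measure_pmf (pmf_of_set {-1, 1}))"

definition iid_rewards :: "'a measure \<Rightarrow> (edge \<Rightarrow> 'a \<Rightarrow> real) \<Rightarrow> bool" where
  "iid_rewards M \<eta> \<longleftrightarrow>
     prob_space.indep_vars M (\<lambda>_. borel) \<eta> UNIV \<and>
     (\<forall>e e'. distr M borel (\<eta> e) = distr M borel (\<eta> e'))"

text \<open>Independence of the whole reward field and the whole walk, i.e. of the \<open>\<sigma>\<close>-algebras they
  generate as random elements of the product spaces. The library's \<open>indep_var\<close> cannot be
  used, as it requires both random elements to have the same value type.\<close>
definition rewards_indep_walk ::
    "'a measure \<Rightarrow> (edge \<Rightarrow> 'a \<Rightarrow> real) \<Rightarrow> (nat \<Rightarrow> 'a \<Rightarrow> int) \<Rightarrow> bool" where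
  "rewards_indep_walk M \<eta> W \<longleftrightarrow>
     prob_space.indep_set M
       {(\<lambda>\<omega> e. \<eta> e \<omega>) -` B \<inter> space M | B. B \<in> sets (\<Pi>\<^sub>M e\<in>UNIV. borel)}
       {(\<lambda>\<omega> n. W n \<omega>) -` C \<inter> space M | C. C \<in> sets (\<Pi>\<^sub>M n\<in>UNIV. count_space UNIV)}"

definition walk_with_rewards ::
    "'a measure \<Rightarrow> (edge \<Rightarrow> 'a \<Rightarrow> real) \<Rightarrow> (nat \<Rightarrow> 'a \<Rightarrow> int) \<Rightarrow> bool" where
  "walk_with_rewards M \<eta> W \<longleftrightarrow>
     prob_space M \<and> simple_random_walk M W \<and> iid_rewards M \<eta> \<and> rewards_indep_walk M \<eta> W"

text \<open>\<open>traversed W i \<omega>\<close> is the edge crossed in step \<open>i \<ge> 1\<close>.\<close>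
definition traversed :: "(nat \<Rightarrow> 'a \<Rightarrow> int) \<Rightarrow> nat \<Rightarrow> 'a \<Rightarrow> edge" where
  "traversed W i \<omega> = edge_between (W (i - 1) \<omega>) (W i \<omega>)"

primrec edge_sign :: "(nat \<Rightarrow> 'a \<Rightarrow> int) \<Rightarrow> nat \<Rightarrow> 'a \<Rightarrow> edge \<Rightarrow> real" where
  "edge_sign W 0 \<omega> e = 1"
| "edge_sign W (Suc k) \<omega> e =
     (if e = traversed W (Suc k) \<omega> then - edge_sign W k \<omega> e else edge_sign W k \<omega> e)"

definition scenery_sum ::
    "(edge \<Rightarrow> 'a \<Rightarrow> real) \<Rightarrow> (nat \<Rightarrow> 'a \<Rightarrow> int) \<Rightarrow> nat \<Rightarrow> 'a \<Rightarrow> real" where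
  "scenery_sum \<eta> W n \<omega> = (\<Sum>i=1..n. \<eta> (traversed W i \<omega>) \<omega>)"

definition random_time_sum ::
    "(edge \<Rightarrow> 'a \<Rightarrow> real) \<Rightarrow> (nat \<Rightarrow> 'a \<Rightarrow> int) \<Rightarrow> nat \<Rightarrow> 'a \<Rightarrow> real" where
  "random_time_sum \<eta> W n \<omega> =
     (\<Sum>k=1..n. edge_sign W (k - 1) \<omega> (traversed W k \<omega>) * \<eta> (traversed W k \<omega>) \<omega>)"

definition is_random_walk_in_random_scenery ::
    "'a measure \<Rightarrow> (nat \<Rightarrow> 'a \<Rightarrow> real) \<Rightarrow> (edge \<Rightarrow> 'a \<Rightarrow> real) \<Rightarrow> (nat \<Rightarrow> 'a \<Rightarrow> int) \<Rightarrow> bool" where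
  "is_random_walk_in_random_scenery M X \<eta> W \<longleftrightarrow>
     walk_with_rewards M \<eta> W \<and> (\<forall>\<omega>\<in>space M. \<forall>n. X n \<omega> = scenery_sum \<eta> W n \<omega>)"

definition is_random_walk_at_random_time ::
    "'a measure \<Rightarrow> (nat \<Rightarrow> 'a \<Rightarrow> real) \<Rightarrow> (edge \<Rightarrow> 'a \<Rightarrow> real) \<Rightarrow> (nat \<Rightarrow> 'a \<Rightarrow> int) \<Rightarrow> bool" where
  "is_random_walk_at_random_time M X \<eta> W \<longleftrightarrow>
     walk_with_rewards M \<eta> W \<and> (\<forall>\<omega>\<in>space M. \<forall>n. X n \<omega> = random_time_sum \<eta> W n \<omega>)"

definition variation :: "nat \<Rightarrow> (nat \<Rightarrow> 'a \<Rightarrow> real) \<Rightarrow> nat \<Rightarrow> 'a \<Rightarrow> real" where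
  "variation p X n \<omega> = (\<Sum>i=1..n. (X i \<omega> - X (i - 1) \<omega>) ^ p)"

definition centred_power :: "'a measure \<Rightarrow> nat \<Rightarrow> (edge \<Rightarrow> 'a \<Rightarrow> real) \<Rightarrow> edge \<Rightarrow> 'a \<Rightarrow> real" where
  "centred_power M p \<eta> e \<omega> = \<eta> e \<omega> ^ p - (\<integral>\<omega>'. \<eta> e \<omega>' ^ p \<partial>M)"

definition symmetric_stable :: "real \<Rightarrow> real measure \<Rightarrow> bool" where
  "symmetric_stable \<alpha> \<nu> \<longleftrightarrow>
     real_distribution \<nu> \<and>
     (\<exists>c>0. \<forall>t. char \<nu> t = complex_of_real (exp (- c * \<bar>t\<bar> powr \<alpha>)))"

text \<open>The law \<open>\<mu>\<close> is in the domain of attraction of \<open>\<nu>\<close>: normalised and centred sums of \<open>n\<close>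
  independent \<open>\<mu>\<close>-distributed variables (the coordinates of the \<open>n\<close>-fold product) converge
  weakly to \<open>\<nu>\<close>.\<close>
definition in_domain_of_attraction :: "real measure \<Rightarrow> real measure \<Rightarrow> bool" where
  "in_domain_of_attraction \<mu> \<nu> \<longleftrightarrow>
     (\<exists>a b :: nat \<Rightarrow> real. (\<forall>n. a n > 0) \<and>
        weak_conv_m
          (\<lambda>n. distr (\<Pi>\<^sub>M i\<in>{..<n}. \<mu>) borel (\<lambda>x. (\<Sum>i<n. x i) / a n - b n)) \<nu>)"

end

theory Submission
  imports Defs
begin

text \<open>
  Step \<open>k\<close> of \<open>A\<close> is \<open>\<sigma> * \<eta> (e)\<close>, where \<open>e\<close> is the edge being crossed and \<open>\<sigma>\<close> is its current sign.
  Its \<open>p\<close>-th power is \<open>\<sigma> ^ p * \<eta> (e) ^ p\<close>, and since \<open>\<sigma>\<close> is \<open>1\<close> or \<open>-1\<close> the factor \<open>\<sigma> ^ p\<close> is \<open>\<sigma>\<close> for odd \<open>p\<close>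
  and \<open>1\<close> for even \<open>p\<close>. Hence the \<open>p\<close>-th variation keeps the alternating signs when \<open>p\<close> is odd and
  forgets them when \<open>p\<close> is even. For even \<open>p\<close>, centring the rewards subtracts the same constant
  at each of the \<open>n\<close> steps; for odd \<open>p\<close> the rewards \<open>\<eta> (e) ^ p\<close> have mean zero by symmetry, so that
  centring changes nothing.

  The probabilistic content is that the centred powers are again i.i.d. rewards independent of the
  walk. As the rewards are identically distributed, all of them are centred by one constant, so
  the new field arises from the old one by applying a single Borel function to every reward
  (\<open>centred_power_eq\<close>), and such a transformation preserves all the required properties
  (\<open>walk_with_rewards_transform\<close>).
\<close>

lemma iid_rewards_measurable:
  assumes "prob_space M" "iid_rewards M \<eta>"
  shows "\<eta> e \<in> borel_measurable M"
proof -
  interpret prob_space M by fact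
  show ?thesis
    using assms(2) by (simp add: iid_rewards_def indep_vars_def)
qed

lemma iid_rewards_transform:
  fixes f :: "real \<Rightarrow> real"
  assumes M: "prob_space M" and iid: "iid_rewards M \<eta>" and f: "f \<in> borel_measurable borel"
  shows "iid_rewards M (\<lambda>e \<omega>. f (\<eta> e \<omega>))"
proof -
  interpret prob_space M by fact
  have meas: "\<eta> e \<in> borel_measurable M" for e
    using M iid by (rule iid_rewards_measurable)
  have "indep_vars (\<lambda>_. borel) (\<lambda>e \<omega>. f (\<eta> e \<omega>)) UNIV"
  proof (rule indep_vars_compose2[where X = \<eta> and Y = "\<lambda>_. f"])
    show "indep_vars (\<lambda>_. borel) \<eta> UNIV"
      using iid unfolding iid_rewards_def by blast
  qed (rule f)
  moreover have "distr M borel (\<lambda>\<omega>. f (\<eta> e \<omega>)) = distr M borel (\<lambda>\<omega>. f (\<eta> e' \<omega>))" for e e'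
  proof -
    have "distr M borel (\<lambda>\<omega>. f (\<eta> d \<omega>)) = distr (distr M borel (\<eta> d)) borel f" for d
      using f meas by (simp add: distr_distr o_def)
    moreover have "distr M borel (\<eta> e) = distr M borel (\<eta> e')"
      using iid unfolding iid_rewards_def by blast
    ultimately show ?thesis by simp
  qed
  ultimately show ?thesis unfolding iid_rewards_def by blast
qed

text \<open>
  Applying \<open>f\<close> to every coordinate is a measurable map of the product space to itself, so the
  transformed field generates a smaller \<open>\<sigma>\<close>-algebra than the original one.
\<close>

lemma rewards_indep_walk_transform:
  fixes f :: "real \<Rightarrow> real"
  assumes M: "prob_space M" and indep: "rewards_indep_walk M \<eta> W"
    and f: "f \<in> borel_measurable borel"
  shows "rewards_indep_walk M (\<lambda>e \<omega>. f (\<eta> e \<omega>)) W"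
proof -
  interpret prob_space M by fact
  let ?P = "\<Pi>\<^sub>M e\<in>UNIV. (borel :: real measure)"
  let ?F = "\<lambda>x e. f (x e) :: real"
  let ?S = "{(\<lambda>\<omega> e. f (\<eta> e \<omega>)) -` B \<inter> space M | B. B \<in> sets ?P}"
  let ?R = "{(\<lambda>\<omega> e. \<eta> e \<omega>) -` B \<inter> space M | B. B \<in> sets ?P}"
  have F: "?F \<in> measurable ?P ?P"
    by (rule measurable_PiM_single')
      (auto simp: space_PiM intro!: measurable_compose[OF _ f] measurable_component_singleton)
  have sub: "?S \<subseteq> ?R"
  proof
    fix X assume "X \<in> ?S"
    then obtain B where B: "B \<in> sets ?P" and X: "X = (\<lambda>\<omega> e. f (\<eta> e \<omega>)) -` B \<inter> space M"
      by blast
    have "?F -` B \<in> sets ?P"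
      using measurable_sets[OF F B] by (simp add: space_PiM)
    moreover have "X = (\<lambda>\<omega> e. \<eta> e \<omega>) -` (?F -` B) \<inter> space M"
      using X by (simp add: vimage_def)
    ultimately show "X \<in> ?R" by blast
  qed
  show ?thesis
    using indep unfolding rewards_indep_walk_def indep_set_def
    by (rule indep_sets_mono_sets) (use sub in \<open>auto split: bool.split\<close>)
qed

lemma walk_with_rewards_transform:
  fixes f :: "real \<Rightarrow> real"
  assumes "walk_with_rewards M \<eta> W" "f \<in> borel_measurable borel"
  shows "walk_with_rewards M (\<lambda>e \<omega>. f (\<eta> e \<omega>)) W"
  using assms iid_rewards_transform rewards_indep_walk_transform
  unfolding walk_with_rewards_def by blast

lemma iid_rewards_moment_eq:
  assumes "prob_space M" and iid: "iid_rewards M \<eta>"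
  shows "(\<integral>\<omega>. \<eta> e \<omega> ^ p \<partial>M) = (\<integral>\<omega>. \<eta> e' \<omega> ^ p \<partial>M)"
proof -
  have "(\<integral>\<omega>. \<eta> d \<omega> ^ p \<partial>M) = (\<integral>x. x ^ p \<partial>distr M borel (\<eta> d))" for d
    using iid_rewards_measurable[OF assms, of d] by (simp add: integral_distr)
  moreover have "distr M borel (\<eta> e) = distr M borel (\<eta> e')"
    using iid unfolding iid_rewards_def by blast
  ultimately show ?thesis by simp
qed

text \<open>
  The edge \<open>e\<close> is an arbitrary representative: its moment serves to centre the reward on any
  other edge, because the rewards have a common law.
\<close>

lemma centred_power_eq:
  assumes "prob_space M" "iid_rewards M \<eta>"
  shows "centred_power M p \<eta> = (\<lambda>e' \<omega>. \<eta> e' \<omega> ^ p - (\<integral>\<omega>'. \<eta> e \<omega>' ^ p \<partial>M))"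
  using iid_rewards_moment_eq[OF assms, of _ p e] by (intro ext) (simp add: centred_power_def)

lemma walk_with_rewards_centred_power:
  assumes "walk_with_rewards M \<eta> W"
  shows "walk_with_rewards M (centred_power M p \<eta>) W"
proof -
  fix e :: edge
  have "centred_power M p \<eta> = (\<lambda>e' \<omega>. \<eta> e' \<omega> ^ p - (\<integral>\<omega>'. \<eta> e \<omega>' ^ p \<partial>M))"
    using assms by (intro centred_power_eq) (auto simp: walk_with_rewards_def)
  then show ?thesis
    using walk_with_rewards_transform[OF assms, of "\<lambda>x. x ^ p - (\<integral>\<omega>'. \<eta> e \<omega>' ^ p \<partial>M)"]
    by simp
qed

text \<open>
  The variables \<open>X\<close> and \<open>- X\<close> have the same law, hence equal \<open>p\<close>-th moments; for odd \<open>p\<close> these moments are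
  also negatives of each other.
\<close>

lemma symmetric_odd_moment_zero:
  fixes X :: "'a \<Rightarrow> real"
  assumes X: "X \<in> borel_measurable M"
    and symmetric: "distr M borel (\<lambda>\<omega>. - X \<omega>) = distr M borel X"
    and "odd p"
  shows "(\<integral>\<omega>. X \<omega> ^ p \<partial>M) = 0"
proof -
  have "(\<integral>\<omega>. X \<omega> ^ p \<partial>M) = (\<integral>x. x ^ p \<partial>distr M borel X)"
    using X by (simp add: integral_distr)
  also have "\<dots> = (\<integral>x. x ^ p \<partial>distr M borel (\<lambda>\<omega>. - X \<omega>))"
    by (simp add: symmetric)
  also have "\<dots> = (\<integral>\<omega>. (- X \<omega>) ^ p \<partial>M)"
    using X by (simp add: integral_distr)
  also have "\<dots> = - (\<integral>\<omega>. X \<omega> ^ p \<partial>M)"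
    using \<open>odd p\<close> by simp
  finally show ?thesis by simp
qed

lemma edge_sign_cases: "edge_sign W n \<omega> e = 1 \<or> edge_sign W n \<omega> e = -1"
  by (induction n) auto

lemma edge_sign_power_even: "even p \<Longrightarrow> edge_sign W n \<omega> e ^ p = 1"
  using edge_sign_cases[of W n \<omega> e] by auto

lemma edge_sign_power_odd: "odd p \<Longrightarrow> edge_sign W n \<omega> e ^ p = edge_sign W n \<omega> e"
  using edge_sign_cases[of W n \<omega> e] by auto

lemma variation_random_time_sum:
  assumes "\<And>n. A n \<omega> = random_time_sum \<eta> W n \<omega>"
  shows "variation p A n \<omega> =
    (\<Sum>k=1..n. edge_sign W (k - 1) \<omega> (traversed W k \<omega>) ^ p * \<eta> (traversed W k \<omega>) \<omega> ^ p)"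
  unfolding variation_def
proof (rule sum.cong)
  fix k assume "k \<in> {1..n}"
  then obtain j where "k = Suc j" by (cases k) auto
  then show "(A k \<omega> - A (k - 1) \<omega>) ^ p =
      edge_sign W (k - 1) \<omega> (traversed W k \<omega>) ^ p * \<eta> (traversed W k \<omega>) \<omega> ^ p"
    by (simp add: assms random_time_sum_def power_mult_distrib)
qed simp

theorem theorem2p1:
  fixes M :: "'a measure"
    and W :: "nat \<Rightarrow> 'a \<Rightarrow> int"
    and \<eta> :: "edge \<Rightarrow> 'a \<Rightarrow> real"
    and A :: "nat \<Rightarrow> 'a \<Rightarrow> real"
    and \<alpha> :: real
    and p :: nat
  assumes A: "is_random_walk_at_random_time M A \<eta> W"
    and alpha: "0 < \<alpha>" "\<alpha> \<le> 2"
    and attraction: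
      "\<And>e. \<exists>\<nu>. symmetric_stable \<alpha> \<nu> \<and> in_domain_of_attraction (distr M borel (\<eta> e)) \<nu>"
    and symmetric: "\<And>e. distr M borel (\<lambda>\<omega>. - \<eta> e \<omega>) = distr M borel (\<eta> e)"
    and moment: "\<And>e. integrable M (\<lambda>\<omega>. \<bar>\<eta> e \<omega>\<bar> ^ p)"
  shows "(odd p \<longrightarrow>
            is_random_walk_at_random_time M (variation p A) (centred_power M p \<eta>) W) \<and>
         (even p \<longrightarrow>
            (\<forall>e. is_random_walk_in_random_scenery M
                   (\<lambda>n \<omega>. variation p A n \<omega> - real n * (\<integral>\<omega>'. \<eta> e \<omega>' ^ p \<partial>M))
                   (centred_power M p \<eta>) W))"
proof -
  have wr: "walk_with_rewards M \<eta> W"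
    and A_eq: "\<And>\<omega> n. \<omega> \<in> space M \<Longrightarrow> A n \<omega> = random_time_sum \<eta> W n \<omega>"
    using A by (auto simp: is_random_walk_at_random_time_def)
  then have M: "prob_space M" and iid: "iid_rewards M \<eta>"
    by (auto simp: walk_with_rewards_def)
  have wr': "walk_with_rewards M (centred_power M p \<eta>) W"
    using wr by (rule walk_with_rewards_centred_power)
  have "variation p A n \<omega> = random_time_sum (centred_power M p \<eta>) W n \<omega>"
    if "odd p" "\<omega> \<in> space M" for n \<omega>
  proof -
    have "(\<integral>\<omega>'. \<eta> e \<omega>' ^ p \<partial>M) = 0" for e
      using symmetric_odd_moment_zero iid_rewards_measurable[OF M iid] symmetric \<open>odd p\<close> by blast
    then show ?thesis
      using that variation_random_time_sum[of A \<omega> \<eta> W p n, OF A_eq]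
      by (simp add: random_time_sum_def centred_power_def edge_sign_power_odd)
  qed
  moreover have "variation p A n \<omega> - real n * (\<integral>\<omega>'. \<eta> e \<omega>' ^ p \<partial>M) =
      scenery_sum (centred_power M p \<eta>) W n \<omega>"
    if "even p" "\<omega> \<in> space M" for n \<omega> e
    using that variation_random_time_sum[of A \<omega> \<eta> W p n, OF A_eq]
    by (simp add: scenery_sum_def centred_power_eq[OF M iid, of p e] edge_sign_power_even
        sum_subtractf)
  ultimately show ?thesis
    using wr' by (simp add: is_random_walk_at_random_time_def is_random_walk_in_random_scenery_def)
qed

end
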